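(* For $n\ge2$ let $R_n$ be the linear hexagonal cylinder chain with vertices $p_i,q_i,u_i,v_i$, $i\in\{1,\dots,n\}$ (indices modulo $n$) and edges $p_iq_i$, $p_iu_i$, $u_ip_{i+1}$, $q_iv_i$, $v_iq_{i+1}$; let $r=r_{R_n}$ denote resistance distance in $R_n$, and $\alpha=3-2\sqrt2$. Then: (i) for every fixed integer $i\ge1$, $$\lim_{n\to\infty}r(p_1,p_i)=i-1+\frac{1-\alpha^{i-1}}{2\sqrt2},\qquad \lim_{n\to\infty}r(p_1,q_i)=i-1+\frac{1+\alpha^{i-1}}{2\sqrt2};$$ (ii) $\lim_{n\to\infty}\frac1n r(p_1,p_{\lfloor\frac{n+2}{2}\rfloor})=\lim_{n\to\infty}\frac1n r(p_1,q_{\lfloor\frac{n+2}{2}\rfloor})=\frac14$; (iii) $\lim_{n\to\infty}\big[r_{R_{n+1}}(p_1,p_{\lfloor\frac{n+3}{2}\rfloor})-r_{R_n}(p_1,p_{\lfloor\frac{n+2}{2}\rfloor})\big]=\lim_{n\to\infty}\big[r_{R_{n+1}}(p_1,q_{\lfloor\frac{n+3}{2}\rfloor})-r_{R_n}(p_1,q_{\lfloor\frac{n+2}{2}\rfloor})\big]=\frac14$; (iv) $\lim_{n\to\infty}r(p_1,p_2)=2-\frac{\sqrt2}{2}$ and $\lim_{n\to\infty}r(p_1,q_1)=\frac{\sqrt2}{2}$.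
   Context: The resistance distance $r(a,b)$ is the effective resistance between $a$ and $b$ when each edge is a unit resistor. *)

theory Defs
  imports Complex_Main "Graph_Theory.Pair_Digraph"
begin

(* Kirchhoff's and Ohm's laws for unit resistors: phi is a potential on G that drives a current
   of strength 1 from a to b.  The current through the edge from x to y is phi x - phi y, and the
   net current leaving x is 1 at a, -1 at b and 0 elsewhere (identically 0 if a = b).
   An undirected edge is given by its two opposite arcs, so the sum over the arcs leaving x is
   the sum over the edges at x. *)

definition unit_current_potential ::
  "'a pair_pre_digraph \<Rightarrow> 'a \<Rightarrow> 'a \<Rightarrow> ('a \<Rightarrow> real) \<Rightarrow> bool" where
  "unit_current_potential G a b \<phi> \<longleftrightarrow>
     (\<forall>x \<in> pverts G. (\<Sum>y \<in> {y. (x, y) \<in> parcs G}. \<phi> x - \<phi> y)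
        = (if x = a then 1 else 0) - (if x = b then 1 else 0))"

(* The potential is unique only up to an additive constant; the potential difference between
   a and b is unique for a, b in a finite connected graph. *)

definition resistance_distance :: "'a pair_pre_digraph \<Rightarrow> 'a \<Rightarrow> 'a \<Rightarrow> real" where
  "resistance_distance G a b =
     (THE r. \<exists>\<phi>. unit_current_potential G a b \<phi> \<and> r = \<phi> a - \<phi> b)"

datatype hex_vertex = Pv nat | Qv nat | Uv nat | Vv nat

(* Indices are read modulo n, so that the vertex with index n is also the one with index 0. *)

abbreviation p_vert :: "nat \<Rightarrow> nat \<Rightarrow> hex_vertex" where "p_vert n i \<equiv> Pv (i mod n)"
abbreviation q_vert :: "nat \<Rightarrow> nat \<Rightarrow> hex_vertex" where "q_vert n i \<equiv> Qv (i mod n)"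
abbreviation u_vert :: "nat \<Rightarrow> nat \<Rightarrow> hex_vertex" where "u_vert n i \<equiv> Uv (i mod n)"
abbreviation v_vert :: "nat \<Rightarrow> nat \<Rightarrow> hex_vertex" where "v_vert n i \<equiv> Vv (i mod n)"

definition hex_edges :: "nat \<Rightarrow> hex_vertex set set" where
  "hex_edges n = (\<Union>i \<in> {1..n}.
     {{p_vert n i, q_vert n i},
      {p_vert n i, u_vert n i}, {u_vert n i, p_vert n (i + 1)},
      {q_vert n i, v_vert n i}, {v_vert n i, q_vert n (i + 1)}})"

(* The graph R_n.  It is meant for n >= 2; for n = 1 the set of edges would merge parallel edges. *)

definition hex_cylinder :: "nat \<Rightarrow> hex_vertex pair_pre_digraph" where
  "hex_cylinder n =
     \<lparr>pverts = (\<Union>i \<in> {1..n}. {p_vert n i, q_vert n i, u_vert n i, v_vert n i}),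
      parcs = {(x, y). {x, y} \<in> hex_edges n}\<rparr>"

lemma pair_graph_hex_cylinder: "pair_graph (hex_cylinder n)"
proof -
  let ?V = "pverts (hex_cylinder n)"
  let ?A = "parcs (hex_cylinder n)"
  have fin: "finite ?V"
    by (simp add: hex_cylinder_def)
  have ends: "x \<in> ?V \<and> y \<in> ?V \<and> x \<noteq> y" if "(x, y) \<in> ?A" for x y
  proof -
    from that have "{x, y} \<in> hex_edges n"
      by (simp add: hex_cylinder_def)
    then obtain i where i: "i \<in> {1..n}"
      and e: "{x, y} \<in> {{p_vert n i, q_vert n i},
        {p_vert n i, u_vert n i}, {u_vert n i, p_vert n (i + 1)},
        {q_vert n i, v_vert n i}, {v_vert n i, q_vert n (i + 1)}}"
      unfolding hex_edges_def by (rule UN_E)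
    have V: "{p_vert n i, q_vert n i, u_vert n i, v_vert n i} \<subseteq> ?V"
      if "i \<in> {1..n}" for i
    proof -
      have "{p_vert n i, q_vert n i, u_vert n i, v_vert n i}
        \<subseteq> (\<Union>i \<in> {1..n}. {p_vert n i, q_vert n i, u_vert n i, v_vert n i})"
        using that by (rule UN_upper)
      then show ?thesis
        by (simp only: hex_cylinder_def pair_pre_digraph.simps)
    qed
    have "\<exists>j \<in> {1..n}. (i + 1) mod n = j mod n"
    proof (cases "i = n")
      case True
      then show ?thesis
        using i mod_add_self1[of n 1] by (intro bexI[of _ 1]) (simp_all only: atLeastAtMost_iff order_refl)
    next
      case False
      then show ?thesis
        using i by (intro bexI[of _ "i + 1"]) simp_all
    qed
    then obtain j where j: "j \<in> {1..n}" "(i + 1) mod n = j mod n"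
      by blast
    have e': "{x, y} \<in> {{p_vert n i, q_vert n i},
        {p_vert n i, u_vert n i}, {u_vert n i, p_vert n j},
        {q_vert n i, v_vert n i}, {v_vert n i, q_vert n j}}"
      using e unfolding j(2) .
    have iV: "p_vert n i \<in> ?V" "q_vert n i \<in> ?V" "u_vert n i \<in> ?V" "v_vert n i \<in> ?V"
      using V[OF i] by (simp_all only: insert_subset)
    have jV: "p_vert n j \<in> ?V" "q_vert n j \<in> ?V"
      using V[OF j(1)] by (simp_all only: insert_subset)
    show ?thesis
      using e' iV jV unfolding insert_iff empty_iff doubleton_eq_iff
      by (elim disjE conjE FalseE) (simp_all only: hex_vertex.distinct simp_thms)
  qed
  have "?A \<subseteq> ?V \<times> ?V"
    using ends by auto
  then have finA: "finite ?A"
    using fin finite_subset by blast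
  have "sym ?A"
    by (simp add: sym_def hex_cylinder_def doubleton_eq_iff insert_commute)
  with ends fin finA show ?thesis
    by unfold_locales (auto simp: symmetric_def)
qed

end

theory Submission
  imports Defs
begin

text \<open>
  A unit current potential is unique up to a constant on a connected graph, because a harmonic
  function has zero energy; so any explicit potential computes the resistance distance.
  Eliminating the vertices \<open>u\<^sub>i\<close> and \<open>v\<^sub>i\<close> leaves two cycles joined by rungs. There the sum of
  the two row potentials satisfies the Poisson equation of a cycle with \<open>n\<close> vertices, and their
  difference satisfies a recurrence with characteristic polynomial \<open>x\<^sup>2 - 6 x + 1\<close>, whose smaller root
  is \<open>\<alpha>\<close>. Both have explicit Green's functions, which give the resistance between vertices
  \<open>k\<close> steps apart as \<open>k (n - k) / n + G 0 - G k\<close> in the same row and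
  \<open>k (n - k) / n + G 0 + G k\<close> across the rows, where
  \<open>G k = (\<alpha>\<^sup>k + \<alpha>\<^sup>n\<^sup>-\<^sup>k) / (2\<surd>2 (1 - \<alpha>\<^sup>n))\<close>.
\<close>

section \<open>Uniqueness of unit current potentials\<close>

text \<open>Weighting the equation at \<open>x\<close> by \<open>h x\<close> and summing gives zero
  for the sum of \<open>h x * (h x - h y)\<close> over all arcs. Reversing the arcs gives the same
  for \<open>h y * (h y - h x)\<close>, and the two add up to the energy, a sum of squares.\<close>

lemma harmonic_const_on_arc:
  fixes h :: "'a \<Rightarrow> real"
  assumes G: "pair_graph G"
    and harm: "\<And>x. x \<in> pverts G \<Longrightarrow> (\<Sum>y \<in> {y. (x, y) \<in> parcs G}. h x - h y) = 0"
    and arc: "(a, b) \<in> parcs G"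
  shows "h a = h b"
proof -
  interpret pair_graph G by (rule G)
  let ?A = "parcs G"
  have sym: "(y, x) \<in> ?A" if "(x, y) \<in> ?A" for x y
    using that sym_arcs by (auto simp: symmetric_def sym_def)
  have fin: "finite {y. (x, y) \<in> ?A}" for x
    by (rule finite_subset[of _ "snd ` ?A"]) (auto intro: rev_image_eqI)
  have A: "?A = Sigma (pverts G) (\<lambda>x. {y. (x, y) \<in> ?A})"
    using in_arcsD1 by auto
  have "(\<Sum>x\<in>pverts G. \<Sum>y\<in>{y. (x, y) \<in> ?A}. h x * (h x - h y)) = 0"
    by (simp add: sum_distrib_left[symmetric] harm)
  then have 1: "(\<Sum>(x, y)\<in>?A. h x * (h x - h y)) = 0"
    by (subst A) (simp add: sum.Sigma fin)
  have 2: "(\<Sum>(x, y)\<in>?A. h y * (h y - h x)) = (\<Sum>(x, y)\<in>?A. h x * (h x - h y))"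
    by (rule sum.reindex_bij_witness[of _ prod.swap prod.swap]) (auto intro: sym)
  have "(\<Sum>(x, y)\<in>?A. (h x - h y)\<^sup>2)
      = (\<Sum>(x, y)\<in>?A. h x * (h x - h y)) + (\<Sum>(x, y)\<in>?A. h y * (h y - h x))"
    by (simp add: sum.distrib[symmetric] power2_eq_square algebra_simps case_prod_unfold)
  then have "(\<Sum>(x, y)\<in>?A. (h x - h y)\<^sup>2) = 0"
    using 1 2 by simp
  then have "\<forall>e\<in>?A. (case e of (x, y) \<Rightarrow> (h x - h y)\<^sup>2) = 0"
    by (subst (asm) sum_nonneg_eq_0_iff) auto
  then show ?thesis
    using arc by force
qed

text \<open>Two potentials for the same \<open>a\<close> and \<open>b\<close> differ by a harmonic
  function, which is constant along the path from \<open>a\<close> to \<open>b\<close>. Hence any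
  explicit potential determines the \<open>THE\<close>.\<close>

lemma resistance_distance_eq:
  assumes G: "pair_graph G" and conn: "(a, b) \<in> (parcs G)\<^sup>*"
    and \<phi>: "unit_current_potential G a b \<phi>"
  shows "resistance_distance G a b = \<phi> a - \<phi> b"
  unfolding resistance_distance_def
proof (rule the_equality)
  fix r assume "\<exists>\<psi>. unit_current_potential G a b \<psi> \<and> r = \<psi> a - \<psi> b"
  then obtain \<psi> where \<psi>: "unit_current_potential G a b \<psi>" "r = \<psi> a - \<psi> b"
    by blast
  let ?h = "\<lambda>x. \<psi> x - \<phi> x"
  have "(\<Sum>y \<in> {y. (x, y) \<in> parcs G}. ?h x - ?h y) = 0" if "x \<in> pverts G" for x
  proof -
    have "(\<Sum>y \<in> {y. (x, y) \<in> parcs G}. ?h x - ?h y)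
      = (\<Sum>y \<in> {y. (x, y) \<in> parcs G}. \<psi> x - \<psi> y) - (\<Sum>y \<in> {y. (x, y) \<in> parcs G}. \<phi> x - \<phi> y)"
      unfolding sum_subtractf[symmetric] by (rule sum.cong) auto
    then show ?thesis
      using that \<phi> \<psi>(1) by (simp add: unit_current_potential_def)
  qed
  then have arc: "?h x = ?h y" if "(x, y) \<in> parcs G" for x y
    using harmonic_const_on_arc[OF G, of ?h x y] that by blast
  from conn have "?h a = ?h b"
  proof (induction rule: rtrancl_induct)
    case base
    show ?case by (rule refl)
  next
    case (step y z)
    then show ?case using arc by metis
  qed
  then show "r = \<phi> a - \<phi> b"
    using \<psi>(2) by simp
qed (use \<phi> in blast)

section \<open>Adjacency in the cylinder and reduction to its two rows\<close>

text \<open>Adding \<open>n - 1\<close> avoids truncated subtraction at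
  \<open>j = 0\<close>.\<close>

definition prev_mod :: "nat \<Rightarrow> nat \<Rightarrow> nat" where
  "prev_mod n j = (j + (n - 1)) mod n"

lemma prev_mod_less: "n > 0 \<Longrightarrow> prev_mod n j < n"
  by (simp add: prev_mod_def)

lemma Suc_mod_eq_iff_prev_mod:
  assumes "i < n" "j < n"
  shows "Suc i mod n = j \<longleftrightarrow> i = prev_mod n j"
  using assms by (cases "Suc i = n"; cases j) (auto simp: prev_mod_def)

lemma Suc_prev_mod: "j < n \<Longrightarrow> Suc (prev_mod n j) mod n = j"
  by (simp add: Suc_mod_eq_iff_prev_mod prev_mod_less)

lemma prev_mod_neq: "2 \<le> n \<Longrightarrow> j < n \<Longrightarrow> prev_mod n j \<noteq> j"
  by (cases j) (auto simp: prev_mod_def)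

text \<open>Allows the graph to be indexed by canonical residues; the index \<open>n\<close>
  supplies the residue 0.\<close>

lemma mod_image_atLeastAtMost: "(\<lambda>i. i mod n) ` {1..n} = {..<n}" for n :: nat
proof (intro equalityI subsetI)
  fix j assume "j \<in> {..<n}"
  then show "j \<in> (\<lambda>i. i mod n) ` {1..n}"
    by (cases "j = 0") (force intro: image_eqI[of _ _ n] image_eqI[of _ _ j])+
qed auto

lemma hex_edges_alt:
  "hex_edges n = (\<Union>j<n. {{Pv j, Qv j}, {Pv j, Uv j}, {Uv j, Pv (Suc j mod n)},
     {Qv j, Vv j}, {Vv j, Qv (Suc j mod n)}})"
  unfolding hex_edges_def mod_image_atLeastAtMost[symmetric]
  by (simp add: mod_Suc_eq)

lemma pverts_hex_cylinder:
  "pverts (hex_cylinder n) = (\<Union>j<n. {Pv j, Qv j, Uv j, Vv j})"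
  unfolding hex_cylinder_def mod_image_atLeastAtMost[symmetric] by simp

lemma parcs_hex_cylinder_iff:
  "(x, y) \<in> parcs (hex_cylinder n) \<longleftrightarrow>
     (\<exists>j<n. {x, y} \<in> {{Pv j, Qv j}, {Pv j, Uv j}, {Uv j, Pv (Suc j mod n)},
     {Qv j, Vv j}, {Vv j, Qv (Suc j mod n)}})"
  by (simp only: hex_cylinder_def hex_edges_alt pair_pre_digraph.simps mem_Collect_eq
      case_prod_conv UN_iff lessThan_iff Bex_def)

lemma hex_neighbours:
  assumes "j < n"
  shows "{y. (Pv j, y) \<in> parcs (hex_cylinder n)} = {Qv j, Uv j, Uv (prev_mod n j)}"
    and "{y. (Qv j, y) \<in> parcs (hex_cylinder n)} = {Pv j, Vv j, Vv (prev_mod n j)}"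
    and "{y. (Uv j, y) \<in> parcs (hex_cylinder n)} = {Pv j, Pv (Suc j mod n)}"
    and "{y. (Vv j, y) \<in> parcs (hex_cylinder n)} = {Qv j, Qv (Suc j mod n)}"
proof -
  \<comment> \<open>Solving for the edge index \<open>i\<close> reduces the existential quantifiers
    in the adjacency relation to one-point cases, which \<open>**\<close> eliminates.\<close>
  have *: "Suc i mod n = j \<longleftrightarrow> i = prev_mod n j" "j = Suc i mod n \<longleftrightarrow> i = prev_mod n j" if "i < n" for i
    using Suc_mod_eq_iff_prev_mod[OF that assms] by auto
  have **: "(\<exists>i<n. i = k \<and> P i) \<longleftrightarrow> k < n \<and> P k" "(\<exists>i<n. k = i \<and> P i) \<longleftrightarrow> k < n \<and> P k" for k P
    by auto
  show "{y. (Pv j, y) \<in> parcs (hex_cylinder n)} = {Qv j, Uv j, Uv (prev_mod n j)}"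
    and "{y. (Qv j, y) \<in> parcs (hex_cylinder n)} = {Pv j, Vv j, Vv (prev_mod n j)}"
    and "{y. (Uv j, y) \<in> parcs (hex_cylinder n)} = {Pv j, Pv (Suc j mod n)}"
    and "{y. (Vv j, y) \<in> parcs (hex_cylinder n)} = {Qv j, Qv (Suc j mod n)}"
    using assms prev_mod_less[of n j]
    by (auto simp: parcs_hex_cylinder_iff doubleton_eq_iff * ** ex_disj_distrib
        conj_disj_distribL conj_disj_distribR cong: conj_cong)
qed

text \<open>Away from the source and the sink, Kirchhoff's law forces the average of the neighbours'
  potentials on every vertex of degree 2.\<close>

definition hex_extend :: "nat \<Rightarrow> (nat \<Rightarrow> real) \<Rightarrow> (nat \<Rightarrow> real) \<Rightarrow> hex_vertex \<Rightarrow> real" where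
  "hex_extend n p q x = (case x of Pv j \<Rightarrow> p j | Qv j \<Rightarrow> q j
     | Uv j \<Rightarrow> (p j + p (Suc j mod n)) / 2 | Vv j \<Rightarrow> (q j + q (Suc j mod n)) / 2)"

text \<open>The weight 1/2 is the conductance of two unit resistors in series, namely the path
  through a vertex \<open>Uv\<close> or \<open>Vv\<close>.\<close>

definition cycle_laplacian :: "nat \<Rightarrow> (nat \<Rightarrow> real) \<Rightarrow> nat \<Rightarrow> real" where
  "cycle_laplacian n f j = f j - (f (Suc j mod n) + f (prev_mod n j)) / 2"

text \<open>Only the balance at row vertices is left to require: the rung carries
  \<open>p j - q j\<close>, the two row connections carry the Laplacian. By \<open>ab\<close>,
  source and sink avoid the averaged vertices.\<close>

lemma unit_current_potential_hex_extend:
  assumes n: "2 \<le> n" and ab: "a \<in> range Pv \<union> range Qv" "b \<in> range Pv \<union> range Qv"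
    and P: "\<And>j. j < n \<Longrightarrow> cycle_laplacian n p j + (p j - q j) = of_bool (Pv j = a) - of_bool (Pv j = b)"
    and Q: "\<And>j. j < n \<Longrightarrow> cycle_laplacian n q j + (q j - p j) = of_bool (Qv j = a) - of_bool (Qv j = b)"
  shows "unit_current_potential (hex_cylinder n) a b (hex_extend n p q)"
  unfolding unit_current_potential_def
proof
  fix x assume "x \<in> pverts (hex_cylinder n)"
  then obtain j where j: "j < n" and x: "x \<in> {Pv j, Qv j, Uv j, Vv j}"
    unfolding pverts_hex_cylinder by auto
  \<comment> \<open>The sums range over sets of neighbours, so these must be distinct for every edge
    to count; this is where \<open>n\<close> \<ge> 2 enters.\<close>
  have neq: "Suc j mod n \<noteq> j"
    using Suc_mod_eq_iff_prev_mod[OF j j] prev_mod_neq[OF n j] by auto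
  consider "x = Pv j" | "x = Qv j" | "x = Uv j" | "x = Vv j"
    using x by blast
  then show "(\<Sum>y \<in> {y. (x, y) \<in> parcs (hex_cylinder n)}. hex_extend n p q x - hex_extend n p q y)
        = (if x = a then 1 else 0) - (if x = b then 1 else 0)"
  proof cases
    case 1
    then show ?thesis
      using P[OF j] prev_mod_neq[OF n j] unfolding 1 hex_neighbours[OF j]
      by (simp add: hex_extend_def cycle_laplacian_def Suc_prev_mod[OF j] of_bool_def field_simps)
  next
    case 2
    then show ?thesis
      using Q[OF j] prev_mod_neq[OF n j] unfolding 2 hex_neighbours[OF j]
      by (simp add: hex_extend_def cycle_laplacian_def Suc_prev_mod[OF j] of_bool_def field_simps)
  next
    case 3
    then show ?thesis
      using ab neq unfolding 3 hex_neighbours[OF j] by (auto simp: hex_extend_def field_simps)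
  next
    case 4
    then show ?thesis
      using ab neq unfolding 4 hex_neighbours[OF j] by (auto simp: hex_extend_def field_simps)
  qed
qed

lemma Suc_step_reachable:
  assumes "\<And>j. j < n \<Longrightarrow> (f j, f (Suc j mod n)) \<in> r\<^sup>*" "n > 0"
  shows "(f (s mod n), f ((s + k) mod n)) \<in> r\<^sup>*"
proof (induction k)
  case (Suc k)
  have "(f ((s + k) mod n), f (Suc ((s + k) mod n) mod n)) \<in> r\<^sup>*"
    using assms by simp
  then show ?case
    using Suc by (simp add: mod_Suc_eq)
qed simp

lemma hex_cylinder_reachable:
  assumes n: "n > 0"
  shows "(p_vert n s, p_vert n (s + k)) \<in> (parcs (hex_cylinder n))\<^sup>*"
    and "(p_vert n s, q_vert n (s + k)) \<in> (parcs (hex_cylinder n))\<^sup>*"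
proof -
  let ?A = "parcs (hex_cylinder n)"
  have "(Pv j, Uv j) \<in> ?A" "(Uv j, Pv (Suc j mod n)) \<in> ?A" if "j < n" for j
    using that hex_neighbours(1,3)[OF that] by blast+
  then have "(Pv j, Pv (Suc j mod n)) \<in> ?A\<^sup>*" if "j < n" for j
    using that by (meson converse_rtrancl_into_rtrancl r_into_rtrancl)
  then show 1: "(p_vert n s, p_vert n (s + k)) \<in> ?A\<^sup>*"
    using n by (rule Suc_step_reachable)
  have "(p_vert n (s + k), q_vert n (s + k)) \<in> ?A"
    using hex_neighbours(1)[of "(s + k) mod n" n] n by auto
  with 1 show "(p_vert n s, q_vert n (s + k)) \<in> ?A\<^sup>*"
    by (rule rtrancl_into_rtrancl)
qed

section \<open>Distance on the cycle and the two Green's functions\<close>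

text \<open>Directed distance: the number of forward steps from \<open>s\<close> to \<open>j\<close>.\<close>

definition cycle_dist :: "nat \<Rightarrow> nat \<Rightarrow> nat \<Rightarrow> nat" where
  "cycle_dist n s j = (j + (n - s mod n)) mod n"

lemma cycle_dist_less: "n > 0 \<Longrightarrow> cycle_dist n s j < n"
  by (simp add: cycle_dist_def)

lemma cycle_dist_eq_0_iff:
  assumes "j < n"
  shows "cycle_dist n s j = 0 \<longleftrightarrow> j = s mod n"
proof -
  define m where "m = s mod n"
  have m: "m < n" using assms by (simp add: m_def)
  have "(j + (n - m)) mod n = 0 \<longleftrightarrow> j = m"
  proof (cases "j < m")
    case True
    then have "j + (n - m) < n" "j + (n - m) \<noteq> 0" using m by linarith+
    then show ?thesis using True by (simp only: mod_less) simp
  next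
    case False
    then have "j + (n - m) = (j - m) + n" using m by simp
    then have "(j + (n - m)) mod n = j - m"
      using assms by (simp only: mod_add_self2) simp
    then show ?thesis using False by auto
  qed
  then show ?thesis
    by (simp add: cycle_dist_def m_def)
qed

text \<open>Going back \<open>k\<close> steps means going forward \<open>n - k\<close>. The outer
  \<open>mod n\<close> matters only at \<open>k = n\<close> in the first claim and
  \<open>k = 0\<close> in the second.\<close>

lemma cycle_dist_add:
  assumes "n > 0"
  shows "cycle_dist n s ((s + k) mod n) = k mod n"
    and "k \<le> n \<Longrightarrow> cycle_dist n (s + k) (s mod n) = (n - k) mod n"
proof -
  have s: "s mod n < n" using assms by simp
  have "((s + k) mod n + (n - s mod n)) mod n = ((s mod n + k) + (n - s mod n)) mod n"
    by (metis mod_add_left_eq)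
  also have "(s mod n + k) + (n - s mod n) = k + n"
    using s by simp
  finally show "cycle_dist n s ((s + k) mod n) = k mod n"
    by (simp add: cycle_dist_def)
  assume k: "k \<le> n"
  have t: "(s + k) mod n < n" using assms by simp
  have "(s mod n + (n - (s + k) mod n)) mod n = (s + n + (n - (s + k) mod n)) mod n"
    by (metis mod_add_left_eq mod_add_self2)
  also have "s + n = (s + k) + (n - k)"
    using k by simp
  also have "((s + k) + (n - k) + (n - (s + k) mod n)) mod n
      = ((s + k) mod n + (n - k) + (n - (s + k) mod n)) mod n"
    by (metis mod_add_left_eq)
  also have "(s + k) mod n + (n - k) + (n - (s + k) mod n) = (n - k) + n"
    using t by simp
  finally show "cycle_dist n (s + k) (s mod n) = (n - k) mod n"
    by (simp add: cycle_dist_def)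
qed

text \<open>The neighbours of \<open>j\<close> lie at distances \<open>d + 1\<close> and
  \<open>d - 1\<close> modulo \<open>n\<close>. Since \<open>f n = f 0\<close>, only the predecessor
  of distance 0 needs a case distinction.\<close>

lemma cycle_laplacian_cycle_dist:
  fixes n s j :: nat
  assumes n: "n > 0" and f: "f n = f 0" and j: "j < n"
  defines "d \<equiv> cycle_dist n s j"
  shows "cycle_laplacian n (\<lambda>j. f (cycle_dist n s j)) j
    = f d - (f (Suc d) + f (if d = 0 then n - 1 else d - 1)) / 2"
proof -
  have d: "d < n" unfolding d_def using n by (rule cycle_dist_less)
  have fmod: "f (Suc d mod n) = f (Suc d)"
    using d f by (cases "Suc d = n") auto
  have 1: "cycle_dist n s (Suc j mod n) = Suc d mod n"
    by (simp add: d_def cycle_dist_def mod_simps)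
  have "cycle_dist n s (prev_mod n j) = (d + (n - 1)) mod n"
    by (simp add: d_def cycle_dist_def prev_mod_def mod_simps add_ac)
  also have "\<dots> = (if d = 0 then n - 1 else d - 1)"
    using d by (cases d) auto
  finally show ?thesis
    using 1 fmod by (simp add: cycle_laplacian_def d_def[symmetric])
qed

text \<open>
  On the cycle of length \<open>n\<close>, the functions \<open>- cycle_resistance n\<close> and \<open>hex_green n\<close> of the
  distance from a source are Green's functions of the two operators into which the Laplacian of the
  cylinder splits: \<open>L\<close> on the sums \<open>P + Q\<close>, up to the constant \<open>1 / n\<close> which cancels between a
  source and a sink, and \<open>L + 2\<close> on the differences \<open>P - Q\<close>.
\<close>

definition cycle_resistance :: "nat \<Rightarrow> nat \<Rightarrow> real" where
  "cycle_resistance n k = real k * (real n - real k) / real n"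

definition hex_green :: "nat \<Rightarrow> nat \<Rightarrow> real" where
  "hex_green n k = ((3 - 2 * sqrt 2) ^ k + (3 - 2 * sqrt 2) ^ (n - k))
     / (2 * sqrt 2 * (1 - (3 - 2 * sqrt 2) ^ n))"

lemma cycle_resistance_ends [simp]: "cycle_resistance n 0 = 0" "cycle_resistance n n = 0"
  by (simp_all add: cycle_resistance_def)

lemma hex_green_end [simp]: "hex_green n n = hex_green n 0"
  by (simp add: hex_green_def add.commute)

lemma cycle_resistance_symmetric: "k \<le> n \<Longrightarrow> cycle_resistance n (n - k) = cycle_resistance n k"
  by (simp add: cycle_resistance_def of_nat_diff mult.commute)

lemma hex_green_symmetric: "k \<le> n \<Longrightarrow> hex_green n (n - k) = hex_green n k"
  by (simp add: hex_green_def add.commute)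

lemma hex_alpha_bounds: "0 < 3 - 2 * sqrt 2" "3 - 2 * sqrt 2 < 1"
proof -
  have "sqrt 2 < sqrt ((3/2)\<^sup>2)" "sqrt 1 < sqrt 2"
    by (simp_all only: real_sqrt_less_iff) (simp_all add: power2_eq_square)
  then show "0 < 3 - 2 * sqrt 2" "3 - 2 * sqrt 2 < 1"
    by simp_all
qed

text \<open>\<open>(L + 2) g = 0\<close> reads \<open>6 * g d = g (d + 1) + g (d - 1)\<close>; this
  is its characteristic equation.\<close>

lemma hex_alpha_square: "(3 - 2 * sqrt 2) * (3 - 2 * sqrt 2) = 6 * (3 - 2 * sqrt 2) - 1"
  by (simp add: algebra_simps)

text \<open>A quadratic in the distance with second difference \<open>- 2 / n\<close>, hence
  Laplacian \<open>1 / n\<close> off the source. At the source both neighbours have value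
  \<open>(n - 1) / n\<close>, which gives \<open>1 / n - 1\<close>.\<close>

lemma cycle_laplacian_cycle_resistance:
  assumes n: "n > 0" and j: "j < n"
  shows "cycle_laplacian n (\<lambda>j. cycle_resistance n (cycle_dist n s j)) j
    = 1 / real n - of_bool (j = s mod n)"
proof -
  define d where "d = cycle_dist n s j"
  have d: "d < n" unfolding d_def using n by (rule cycle_dist_less)
  have d0: "j = s mod n \<longleftrightarrow> d = 0"
    using cycle_dist_eq_0_iff[OF j] by (simp add: d_def)
  show ?thesis
    unfolding cycle_laplacian_cycle_dist[of n "cycle_resistance n" j s, OF n _ j,
        unfolded cycle_resistance_ends, OF refl] d_def[symmetric] d0
    using n d by (cases d) (auto simp: cycle_resistance_def of_nat_diff divide_simps algebra_simps)
qed

text \<open>The characteristic roots are \<open>a\<close> and \<open>1 / a\<close>, so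
  \<open>a ^ k\<close> and \<open>a ^ (n - k)\<close> both solve the recurrence. Their sum agrees at
  0 and \<open>n\<close>, and the denominator \<open>c\<close> normalises the value at the source to
  1.\<close>

lemma cycle_laplacian_hex_green:
  assumes n: "n > 0" and j: "j < n"
  shows "cycle_laplacian n (\<lambda>j. hex_green n (cycle_dist n s j)) j
    + 2 * hex_green n (cycle_dist n s j) = of_bool (j = s mod n)"
proof -
  define d where "d = cycle_dist n s j"
  define a :: real where "a = 3 - 2 * sqrt 2"
  define c where "c = 2 * sqrt 2 * (1 - a ^ n)"
  have d: "d < n" unfolding d_def using n by (rule cycle_dist_less)
  have d0: "j = s mod n \<longleftrightarrow> d = 0"
    using cycle_dist_eq_0_iff[OF j] by (simp add: d_def)
  have a: "a * a = 6 * a - 1" "0 < a" "a < 1"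
    using hex_alpha_square hex_alpha_bounds by (simp_all add: a_def)
  have "a ^ n < 1"
    using a n by (simp add: power_less_one_iff)
  then have c: "c \<noteq> 0"
    by (simp add: c_def)
  define g where "g k = a ^ k + a ^ (n - k)" for k
  have G: "hex_green n k = g k / c" for k
    by (simp add: hex_green_def g_def a_def c_def)
  have "hex_green n d - (hex_green n (Suc d) + hex_green n (if d = 0 then n - 1 else d - 1)) / 2
      + 2 * hex_green n d = of_bool (d = 0)"
  proof (cases d)
    case 0
    obtain m where m: "n = Suc m"
      using n by (cases n) auto
    have s: "2 * sqrt 2 = 3 - a"
      by (simp add: a_def)
    have "a * (a * a ^ m) = 6 * (a * a ^ m) - a ^ m"
      using arg_cong[OF a(1), of "\<lambda>x. x * a ^ m"] by (simp add: algebra_simps)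
    \<comment> \<open>Here \<open>c = (3 - a) * (1 - a ^ n)\<close>, and the recurrence replaces
      \<open>a * a ^ n\<close> by \<open>6 * a ^ n - a ^ m\<close>.\<close>
    then have "3 * (1 + a ^ n) - (a + a ^ m) = c"
      by (simp add: c_def s m algebra_simps)
    moreover have "g 0 = 1 + a ^ n" "g 1 = a + a ^ m" "g m = a ^ m + a"
      by (simp_all add: g_def m)
    ultimately have "3 * g 0 - (g 1 + g m) / 2 = c"
      by (simp add: field_simps)
    then have "(3 * g 0 - (g 1 + g m) / 2) / c = 1"
      using c by simp
    moreover have "n - 1 = m"
      using m by simp
    ultimately show ?thesis
      using 0 by (simp add: G add_divide_distrib diff_divide_distrib)
  next
    case (Suc m)
    obtain l where "n = Suc (d + l)"
      using d less_imp_Suc_add by blast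
    then have l: "n - d = Suc l" "n - Suc d = l" "n - m = Suc (Suc l)"
      using Suc by simp_all
    have "a * (a * a ^ k) = 6 * (a * a ^ k) - a ^ k" for k
      using arg_cong[OF a(1), of "\<lambda>x. x * a ^ k"] by (simp add: algebra_simps)
    \<comment> \<open>Exponent \<open>m = d - 1\<close> serves the powers \<open>a ^ k\<close>,
      exponent \<open>l = n - d - 1\<close> the reflected powers \<open>a ^ (n - k)\<close>.\<close>
    from this[of m] this[of l] have "6 * g d - g (Suc d) - g m = 0"
      using Suc l by (simp add: g_def algebra_simps)
    moreover have "hex_green n d - (hex_green n (Suc d) + hex_green n m) / 2 + 2 * hex_green n d
        = (6 * g d - g (Suc d) - g m) / (2 * c)"
      by (simp add: G add_divide_distrib diff_divide_distrib)
    ultimately show ?thesis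
      using Suc by simp
  qed
  then show ?thesis
    unfolding cycle_laplacian_cycle_dist[of n "hex_green n" j s, OF n hex_green_end j]
      d_def[symmetric] d0 .
qed

lemma cycle_laplacian_lincomb:
  "cycle_laplacian n (\<lambda>j. (f j - g j + x * f' j + y * g' j) / 2) j
    = (cycle_laplacian n f j - cycle_laplacian n g j
       + x * cycle_laplacian n f' j + y * cycle_laplacian n g' j) / 2"
  by (simp add: cycle_laplacian_def algebra_simps add_divide_distrib diff_divide_distrib)

section \<open>Closed form of the resistance distances\<close>

lemma resistance_distance_hex_cylinder:
  assumes n: "2 \<le> n" and k: "k \<le> n"
  shows "resistance_distance (hex_cylinder n) (p_vert n s) (p_vert n (s + k))
      = cycle_resistance n k + (hex_green n 0 - hex_green n k)"
    and "resistance_distance (hex_cylinder n) (p_vert n s) (q_vert n (s + k))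
      = cycle_resistance n k + (hex_green n 0 + hex_green n k)"
proof -
  let ?R = "\<lambda>s j. cycle_resistance n (cycle_dist n s j)"
  let ?G = "\<lambda>s j. hex_green n (cycle_dist n s j)"
  let ?t = "s + k"
  \<comment> \<open>The rows get \<open>p = f x y\<close> and \<open>q = f (- x) (- y)\<close>:
    their sum is \<open>?R ?t - ?R s\<close>, where the constants \<open>1 / n\<close> cancel, and
    their difference is \<open>x * ?G s + y * ?G ?t\<close>.\<close>
  define f where "f x y j = (?R ?t j - ?R s j + x * ?G s j + y * ?G ?t j) / 2" for x y j
  have n0: "n > 0" using n by simp
  \<comment> \<open>Equal values at 0 and \<open>n\<close> absorb the wrap-around at
    \<open>k = n\<close> and \<open>k = 0\<close>.\<close>
  have mod: "f (k mod n) = f k" if "f n = f 0" for f :: "nat \<Rightarrow> real"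
    using that k by (cases "k = n") auto
  have mod': "f ((n - k) mod n) = f k" if "f n = f 0" "f (n - k) = f k" for f :: "nat \<Rightarrow> real"
    using that k by (cases "k = 0") auto
  have ends: "cycle_dist n s (s mod n) = 0" "cycle_dist n ?t (?t mod n) = 0"
    using n0 by (simp_all add: cycle_dist_eq_0_iff)
  have R: "?R s (?t mod n) = cycle_resistance n k" "?R ?t (s mod n) = cycle_resistance n k"
    using n0 k by (simp_all add: cycle_dist_add mod mod' cycle_resistance_symmetric)
  have G: "?G s (?t mod n) = hex_green n k" "?G ?t (s mod n) = hex_green n k"
    using n0 k by (simp_all add: cycle_dist_add mod mod' hex_green_symmetric)
  have LG: "cycle_laplacian n (?G s) j = of_bool (j = s mod n) - 2 * ?G s j" if "j < n" for s j
    using cycle_laplacian_hex_green[OF n0 that, of s] by simp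
  have diff: "f x y j - f (- x) (- y) j = x * ?G s j + y * ?G ?t j" for x y j
    by (simp add: f_def field_simps)
  have L: "cycle_laplacian n (f x y) j + (f x y j - f (- x) (- y) j) = 
      (1 + x) / 2 * of_bool (j = s mod n) + (y - 1) / 2 * of_bool (j = ?t mod n)"
    if "j < n" for x y j
    using that n0 unfolding diff unfolding f_def
    by (simp only: cycle_laplacian_lincomb cycle_laplacian_cycle_resistance[OF n0 that] LG[OF that])
      (simp add: field_simps)
  \<comment> \<open>Source and sink share a row, so the difference \<open>p - q\<close> sees
    opposite charges: \<open>x = 1\<close>, \<open>y = - 1\<close>.\<close>
  have "unit_current_potential (hex_cylinder n) (p_vert n s) (p_vert n ?t)
      (hex_extend n (f 1 (- 1)) (f (- 1) 1))"
    using n by (rule unit_current_potential_hex_extend) (use L[of _ 1 "- 1"] L[of _ "- 1" 1] in simp_all)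
  from resistance_distance_eq[OF pair_graph_hex_cylinder hex_cylinder_reachable(1)[OF n0] this]
  show "resistance_distance (hex_cylinder n) (p_vert n s) (p_vert n (s + k))
      = cycle_resistance n k + (hex_green n 0 - hex_green n k)"
    by (simp only: hex_extend_def hex_vertex.case f_def ends R G cycle_resistance_ends)
      (simp add: field_simps)
  \<comment> \<open>A sink in the other row changes sign in \<open>p - q\<close>, so
    \<open>x = y = 1\<close>.\<close>
  have "unit_current_potential (hex_cylinder n) (p_vert n s) (q_vert n ?t)
      (hex_extend n (f 1 1) (f (- 1) (- 1)))"
    using n by (rule unit_current_potential_hex_extend) (use L[of _ 1 1] L[of _ "- 1" "- 1"] in simp_all)
  from resistance_distance_eq[OF pair_graph_hex_cylinder hex_cylinder_reachable(2)[OF n0] this]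
  show "resistance_distance (hex_cylinder n) (p_vert n s) (q_vert n (s + k))
      = cycle_resistance n k + (hex_green n 0 + hex_green n k)"
    by (simp only: hex_extend_def hex_vertex.case f_def ends R G cycle_resistance_ends)
      (simp add: field_simps)
qed

section \<open>Limits for fixed and for antipodal distance\<close>

lemma hex_green_tendsto:
  "(\<lambda>n. hex_green n k) \<longlonglongrightarrow> (3 - 2 * sqrt 2) ^ k / (2 * sqrt 2)"
proof -
  define a :: real where "a = 3 - 2 * sqrt 2"
  have "(\<lambda>n. a ^ n) \<longlonglongrightarrow> 0"
    using hex_alpha_bounds by (intro LIMSEQ_power_zero) (simp add: a_def)
  moreover from this have "(\<lambda>n. a ^ (n - k)) \<longlonglongrightarrow> 0"
    by (rule filterlim_compose) (rule filterlim_minus_const_nat_at_top)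
  moreover have "2 * sqrt 2 * (1 - 0) \<noteq> 0"
    by simp
  ultimately have "(\<lambda>n. (a ^ k + a ^ (n - k)) / (2 * sqrt 2 * (1 - a ^ n)))
      \<longlonglongrightarrow> (a ^ k + 0) / (2 * sqrt 2 * (1 - 0))"
    by (intro tendsto_divide tendsto_add tendsto_mult tendsto_diff tendsto_const)
  then show ?thesis
    by (simp add: hex_green_def a_def)
qed

text \<open>Both exponents tend to infinity, so antipodal targets in the two rows become equally far
  from the source.\<close>

lemma hex_green_half_tendsto: "(\<lambda>n. hex_green n (n div 2)) \<longlonglongrightarrow> 0"
proof -
  define a :: real where "a = 3 - 2 * sqrt 2"
  have lim: "(\<lambda>n. a ^ n) \<longlonglongrightarrow> 0"
    using hex_alpha_bounds by (intro LIMSEQ_power_zero) (simp add: a_def)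
  have half: "filterlim (\<lambda>n::nat. n div 2) at_top at_top"
    unfolding filterlim_at_top eventually_sequentially
  proof
    fix m :: nat
    show "\<exists>N. \<forall>n\<ge>N. m \<le> n div 2"
      by (rule exI[of _ "2 * m"]) auto
  qed
  then have half': "filterlim (\<lambda>n::nat. n - n div 2) at_top at_top"
    by (rule filterlim_at_top_mono) (intro always_eventually, auto)
  have "(\<lambda>n. (a ^ (n div 2) + a ^ (n - n div 2)) / (2 * sqrt 2 * (1 - a ^ n)))
      \<longlonglongrightarrow> (0 + 0) / (2 * sqrt 2 * (1 - 0))"
    using filterlim_compose[OF lim half] filterlim_compose[OF lim half']
    by (intro tendsto_divide tendsto_add tendsto_mult tendsto_diff tendsto_const lim) simp_all
  then show ?thesis
    by (simp add: hex_green_def a_def)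
qed

text \<open>With \<open>e = n mod 2\<close> and \<open>k = (n - e) / 2\<close>,
  \<open>k * (n - k)\<close> is a quarter of \<open>n * n - e * e\<close>, and
  \<open>e * e = e\<close>.\<close>

lemma cycle_resistance_half:
  "cycle_resistance n (n div 2) = real n / 4 - real (n mod 2) / (4 * real n)"
proof (cases "n = 0")
  case False
  have "real n = 2 * real (n div 2) + real (n mod 2)"
    by (metis div_mult_mod_eq mult.commute of_nat_add of_nat_mult of_nat_numeral)
  moreover have "real (n mod 2) * real (n mod 2) = real (n mod 2)"
    by (cases "even n") (simp_all add: odd_iff_mod_2_eq_one)
  ultimately have "4 * (real (n div 2) * (real n - real (n div 2))) = real n * real n - real (n mod 2)"
    by (simp add: algebra_simps)
  moreover have "cycle_resistance n (n div 2)
      = (4 * (real (n div 2) * (real n - real (n div 2)))) / (4 * real n)"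
    by (simp only: cycle_resistance_def mult_divide_mult_cancel_left_if) simp
  ultimately have "cycle_resistance n (n div 2) = (real n * real n - real (n mod 2)) / (4 * real n)"
    by simp
  then show ?thesis
    using False by (simp add: diff_divide_distrib)
qed (simp add: cycle_resistance_def)

lemma parity_over_n_tendsto: "(\<lambda>n. real (n mod 2) / (4 * real n)) \<longlonglongrightarrow> 0"
proof (rule tendsto_sandwich[OF _ _ tendsto_const lim_1_over_n])
  show "\<forall>\<^sub>F n in sequentially. real (n mod 2) / (4 * real n) \<le> 1 / real n"
  proof (intro always_eventually allI)
    fix n :: nat
    have "real (n mod 2) \<le> 4"
      using mod_less_divisor[of 2 n] by linarith
    then show "real (n mod 2) / (4 * real n) \<le> 1 / real n"
      by (cases "n = 0") (simp_all add: field_simps)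
  qed
qed simp

lemma cycle_resistance_tendsto: "(\<lambda>n. cycle_resistance n k) \<longlonglongrightarrow> real k"
proof -
  have "(\<lambda>n. real k - real k * real k * (1 / real n)) \<longlonglongrightarrow> real k - real k * real k * 0"
    by (intro tendsto_intros lim_1_over_n)
  then have "(\<lambda>n. real k - real k * real k * (1 / real n)) \<longlonglongrightarrow> real k"
    by simp
  moreover have "\<forall>\<^sub>F n in sequentially. real k - real k * real k * (1 / real n) = cycle_resistance n k"
    using eventually_gt_at_top[of 0]
    by eventually_elim (simp add: cycle_resistance_def field_simps)
  ultimately show ?thesis
    by (rule Lim_transform_eventually)
qed

text \<open>Here \<open>g n\<close> is eventually \<open>n / 4\<close> plus a convergent term:
  scaling by \<open>1 / n\<close> removes that term, and its limit \<open>c\<close> cancels in the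
  increment.\<close>

lemma cycle_resistance_half_limits:
  assumes f: "f \<longlonglongrightarrow> c" and g: "\<forall>\<^sub>F n in sequentially. g n = cycle_resistance n (n div 2) + f n"
  shows "(\<lambda>n. 1 / real n * g n) \<longlonglongrightarrow> 1 / 4"
    and "(\<lambda>n. g (n + 1) - g n) \<longlonglongrightarrow> 1 / 4"
proof -
  let ?e = "\<lambda>n. real (n mod 2) / (4 * real n)"
  have "(\<lambda>n. 1 / 4 + 1 / real n * (f n - ?e n)) \<longlonglongrightarrow> 1 / 4 + 0 * (c - 0)"
    by (intro tendsto_intros f lim_1_over_n parity_over_n_tendsto)
  then have "(\<lambda>n. 1 / 4 + 1 / real n * (f n - ?e n)) \<longlonglongrightarrow> 1 / 4"
    by simp
  moreover have "\<forall>\<^sub>F n in sequentially. 1 / 4 + 1 / real n * (f n - ?e n) = 1 / real n * g n"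
    using g eventually_gt_at_top[of 0]
    by eventually_elim (simp add: cycle_resistance_half distrib_left right_diff_distrib)
  ultimately show "(\<lambda>n. 1 / real n * g n) \<longlonglongrightarrow> 1 / 4"
    by (rule Lim_transform_eventually)
  have "(\<lambda>n. 1 / 4 + (f (n + 1) - ?e (n + 1)) - (f n - ?e n)) \<longlonglongrightarrow> 1 / 4 + (c - 0) - (c - 0)"
    by (intro tendsto_intros f parity_over_n_tendsto LIMSEQ_ignore_initial_segment[of _ _ 1])
  then have "(\<lambda>n. 1 / 4 + (f (n + 1) - ?e (n + 1)) - (f n - ?e n)) \<longlonglongrightarrow> 1 / 4"
    by simp
  moreover have "\<forall>\<^sub>F n in sequentially.
      1 / 4 + (f (n + 1) - ?e (n + 1)) - (f n - ?e n) = g (n + 1) - g n"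
    using g eventually_compose_filterlim[OF g filterlim_add_const_nat_at_top[of 1]]
    by eventually_elim (simp add: cycle_resistance_half add_divide_distrib)
  ultimately show "(\<lambda>n. g (n + 1) - g n) \<longlonglongrightarrow> 1 / 4"
    by (rule Lim_transform_eventually)
qed

theorem theorem4p5:
  fixes \<alpha> :: real and r :: "nat \<Rightarrow> hex_vertex \<Rightarrow> hex_vertex \<Rightarrow> real"
  assumes "\<alpha> = 3 - 2 * sqrt 2"
    and "\<And>n. n \<ge> 2 \<Longrightarrow> r n = resistance_distance (hex_cylinder n)"
  shows
    "(\<forall>i::nat. i \<ge> 1 \<longrightarrow>
        (\<lambda>n. r n (p_vert n 1) (p_vert n i))
          \<longlonglongrightarrow> real i - 1 + (1 - \<alpha> ^ (i - 1)) / (2 * sqrt 2) \<and>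
        (\<lambda>n. r n (p_vert n 1) (q_vert n i))
          \<longlonglongrightarrow> real i - 1 + (1 + \<alpha> ^ (i - 1)) / (2 * sqrt 2)) \<and>
     ((\<lambda>n. 1 / real n * r n (p_vert n 1) (p_vert n ((n + 2) div 2))) \<longlonglongrightarrow> 1 / 4 \<and>
      (\<lambda>n. 1 / real n * r n (p_vert n 1) (q_vert n ((n + 2) div 2))) \<longlonglongrightarrow> 1 / 4) \<and>
     ((\<lambda>n. r (n + 1) (p_vert (n + 1) 1) (p_vert (n + 1) ((n + 3) div 2))
          - r n (p_vert n 1) (p_vert n ((n + 2) div 2))) \<longlonglongrightarrow> 1 / 4 \<and>
      (\<lambda>n. r (n + 1) (p_vert (n + 1) 1) (q_vert (n + 1) ((n + 3) div 2))
          - r n (p_vert n 1) (q_vert n ((n + 2) div 2))) \<longlonglongrightarrow> 1 / 4) \<and>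
     ((\<lambda>n. r n (p_vert n 1) (p_vert n 2)) \<longlonglongrightarrow> 2 - sqrt 2 / 2 \<and>
      (\<lambda>n. r n (p_vert n 1) (q_vert n 1)) \<longlonglongrightarrow> sqrt 2 / 2)"
proof -
  have pp: "r n (p_vert n 1) (p_vert n (1 + k)) = cycle_resistance n k + (hex_green n 0 - hex_green n k)"
    and pq: "r n (p_vert n 1) (q_vert n (1 + k)) = cycle_resistance n k + (hex_green n 0 + hex_green n k)"
    if "2 \<le> n" "k \<le> n" for n k
    using resistance_distance_hex_cylinder[OF that, of 1] assms(2)[OF that(1)] by simp_all
  have green_0: "(\<lambda>n. hex_green n 0) \<longlonglongrightarrow> 1 / (2 * sqrt 2)"
    using hex_green_tendsto[of 0] by simp
  have fixed: "(\<lambda>n. r n (p_vert n 1) (p_vert n i)) \<longlonglongrightarrow> real i - 1 + (1 - \<alpha> ^ (i - 1)) / (2 * sqrt 2)"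
    "(\<lambda>n. r n (p_vert n 1) (q_vert n i)) \<longlonglongrightarrow> real i - 1 + (1 + \<alpha> ^ (i - 1)) / (2 * sqrt 2)"
    if "i \<ge> 1" for i
  proof -
    have "\<exists>k. i = 1 + k"
      using that by (rule le_Suc_ex)
    then obtain k where k: "i = 1 + k" ..
    have "(\<lambda>n. cycle_resistance n k + (hex_green n 0 - hex_green n k))
        \<longlonglongrightarrow> real k + (1 / (2 * sqrt 2) - \<alpha> ^ k / (2 * sqrt 2))"
      unfolding assms(1)
      by (rule tendsto_add[OF cycle_resistance_tendsto tendsto_diff[OF green_0 hex_green_tendsto]])
    moreover have "\<forall>\<^sub>F n in sequentially. cycle_resistance n k + (hex_green n 0 - hex_green n k)
        = r n (p_vert n 1) (p_vert n i)"
      \<comment> \<open>The closed form requires both 2 \<le> \<open>n\<close> and \<open>k\<close>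
        \<le> \<open>n\<close>.\<close>
      using eventually_ge_at_top[of "max 2 k"] by eventually_elim (unfold k, rule pp[symmetric], auto)
    ultimately show "(\<lambda>n. r n (p_vert n 1) (p_vert n i))
        \<longlonglongrightarrow> real i - 1 + (1 - \<alpha> ^ (i - 1)) / (2 * sqrt 2)"
      by (simp add: Lim_transform_eventually k diff_divide_distrib)
    have "(\<lambda>n. cycle_resistance n k + (hex_green n 0 + hex_green n k))
        \<longlonglongrightarrow> real k + (1 / (2 * sqrt 2) + \<alpha> ^ k / (2 * sqrt 2))"
      unfolding assms(1)
      by (rule tendsto_add[OF cycle_resistance_tendsto tendsto_add[OF green_0 hex_green_tendsto]])
    moreover have "\<forall>\<^sub>F n in sequentially. cycle_resistance n k + (hex_green n 0 + hex_green n k)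
        = r n (p_vert n 1) (q_vert n i)"
      using eventually_ge_at_top[of "max 2 k"] by eventually_elim (unfold k, rule pq[symmetric], auto)
    ultimately show "(\<lambda>n. r n (p_vert n 1) (q_vert n i))
        \<longlonglongrightarrow> real i - 1 + (1 + \<alpha> ^ (i - 1)) / (2 * sqrt 2)"
      by (simp add: Lim_transform_eventually k add_divide_distrib)
  qed
  \<comment> \<open>The antipodal index lies \<open>n div 2\<close> steps beyond index 1.\<close>
  have half: "(n + 2) div 2 = 1 + n div 2" for n :: nat
    by simp
  \<comment> \<open>Puts the index for \<open>n + 1\<close> into the form that the increment limits
    produce.\<close>
  have n3: "n + 3 = (n + 1) + 2" for n :: nat
    by simp
  have half_pp: "\<forall>\<^sub>F n in sequentially. r n (p_vert n 1) (p_vert n ((n + 2) div 2))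
      = cycle_resistance n (n div 2) + (hex_green n 0 - hex_green n (n div 2))"
    using eventually_ge_at_top[of 2] by eventually_elim (unfold half, rule pp, auto)
  have half_pq: "\<forall>\<^sub>F n in sequentially. r n (p_vert n 1) (q_vert n ((n + 2) div 2))
      = cycle_resistance n (n div 2) + (hex_green n 0 + hex_green n (n div 2))"
    using eventually_ge_at_top[of 2] by eventually_elim (unfold half, rule pq, auto)
  note lims_pp = cycle_resistance_half_limits[OF tendsto_diff[OF green_0 hex_green_half_tendsto] half_pp]
    and lims_pq = cycle_resistance_half_limits[OF tendsto_add[OF green_0 hex_green_half_tendsto] half_pq]
  have s2: "1 / sqrt 2 = sqrt 2 / 2"
    by (simp add: field_simps)
  \<comment> \<open>The last two limits are the cases \<open>i = 2\<close> in the same row and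
    \<open>i = 1\<close> across the rows.\<close>
  have "real 2 - 1 + (1 - \<alpha> ^ (2 - 1)) / (2 * sqrt 2) = 2 - sqrt 2 / 2"
    unfolding assms(1) by (simp add: field_simps)
  moreover have "real 1 - 1 + (1 + \<alpha> ^ (1 - 1)) / (2 * sqrt 2) = sqrt 2 / 2"
    using s2 by simp
  ultimately have "(\<lambda>n. r n (p_vert n 1) (p_vert n 2)) \<longlonglongrightarrow> 2 - sqrt 2 / 2"
    "(\<lambda>n. r n (p_vert n 1) (q_vert n 1)) \<longlonglongrightarrow> sqrt 2 / 2"
    using fixed(1)[of 2] fixed(2)[of 1] by (simp_all only: one_le_numeral order_refl)
  then show ?thesis
    unfolding n3 using fixed lims_pp lims_pq by blast
qed

end
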